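(* Let $L$ be a complete lattice. In the category of partially ordered sets and order preserving maps, the map $\mathtt{Fix}:\mathtt{EGM}(L)\to \mathtt{CBSMSL}(L)^{\mathrm{op}}$, $c\mapsto \mathrm{Fix}(c)$, is left adjoint to the map $\nu:\mathtt{CBSMSL}(L)^{\mathrm{op}}\to\mathtt{EGM}(L)$, $P\mapsto\nu_P$, and $\mathtt{Fix}\circ\nu=\mathrm{id}_{\mathtt{CBSMSL}(L)^{\mathrm{op}}}$. Furthermore, for any $c\in\mathtt{EGM}(L)$, $\hat c=\nu_{\mathrm{Fix}(c)}$, and if for each ordinal $\alpha$ one puts $c^{0}=\mathrm{id}_L$, $c^{\alpha}=c\circ c^{\beta}$ when $\alpha=\beta+1$, and $c^{\alpha}=\bigvee_{\beta<\alpha}c^{\beta}$ (pointwise join) when $\alpha>0$ is a limit ordinal, then for all $\alpha\geq 1$: $c^{\alpha}\in\mathtt{EGM}(L)$, $c\leq c^{\alpha}\leq\hat c$, $\hat c\circ c^{\alpha}=\hat c=c^{\alpha}\circ\hat c$ and $\widehat{c^{\alpha}}=\hat c$.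
   Context: For a poset with smallest element $0$ and largest element $1$, a closure operation is an order preserving endomap $c$ that is extensional ($x\leq c(x)$ for all $x$) and grounded ($c(0)=0$); idempotence is not required. $\mathtt{EGM}(L)$ is the set of closure operations on $L$, ordered pointwise. $\mathrm{Fix}(c)=\{x\in L: c(x)=x\}$. $\mathtt{CBSMSL}(L)$ is the set of complete bounded sub-$\wedge$-semilattices of $L$, i.e. subsets of $L$ containing $0$ and $1$ and closed under arbitrary meets, ordered by inclusion. For $P\in\mathtt{CBSMSL}(L)$ and $y\in L$, $\nu_P(y)=\bigwedge\{x\in P: y\leq x\}$. For $c\in\mathtt{EGM}(L)$ and $y\in L$, $\hat c(y)=\bigwedge\{x\in\mathrm{Fix}(c): y\leq x\}$. *)

theory Defs
  imports "HOL-Algebra.Galois_Connection"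
begin

definition EGM :: "('a::{order_bot,order_top} \<Rightarrow> 'a) set" where
  "EGM = {c. mono c \<and> (\<forall>x. x \<le> c x) \<and> c bot = bot}"

definition EGM_poset :: "('a::{order_bot,order_top} \<Rightarrow> 'a) gorder" where
  "EGM_poset = \<lparr>carrier = EGM, eq = (=), le = (\<le>)\<rparr>"

definition Fix :: "('a \<Rightarrow> 'a) \<Rightarrow> 'a set" where
  "Fix c = {x. c x = x}"

definition CBSMSL :: "'a::complete_lattice set set" where
  "CBSMSL = {P. bot \<in> P \<and> Orderings.top \<in> P \<and> (\<forall>A\<subseteq>P. Inf A \<in> P)}"

definition CBSMSL_poset :: "'a::complete_lattice set gorder" where
  "CBSMSL_poset = \<lparr>carrier = CBSMSL, eq = (=), le = (\<subseteq>)\<rparr>"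

definition nu :: "'a::complete_lattice set \<Rightarrow> 'a \<Rightarrow> 'a" where
  "nu P y = Inf {x \<in> P. y \<le> x}"

definition hat :: "('a::complete_lattice \<Rightarrow> 'a) \<Rightarrow> 'a \<Rightarrow> 'a" where
  "hat c y = Inf {x \<in> Fix c. y \<le> x}"

text \<open>
  Ordinals are represented by the elements of a well-order \<open>r\<close> on an arbitrary type:
  \<open>\<alpha> \<in> Field r\<close> stands for the order type of \<open>underS r \<alpha>\<close>, the set of elements strictly
  below \<open>\<alpha>\<close>. Every well-order arises as such an initial segment (adjoin a top element).
\<close>

definition is_zero :: "'o rel \<Rightarrow> 'o \<Rightarrow> bool" where
  "is_zero r \<alpha> \<longleftrightarrow> underS r \<alpha> = {}"

text \<open>\<open>is_succ r \<beta> \<alpha>\<close> means \<open>\<alpha> = \<beta> + 1\<close>: \<open>\<beta>\<close> is the greatest element strictly below \<open>\<alpha>\<close>.\<close>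

definition is_succ :: "'o rel \<Rightarrow> 'o \<Rightarrow> 'o \<Rightarrow> bool" where
  "is_succ r \<beta> \<alpha> \<longleftrightarrow> \<beta> \<in> underS r \<alpha> \<and> (\<forall>\<gamma>\<in>underS r \<alpha>. (\<gamma>, \<beta>) \<in> r)"

definition iter :: "'o rel \<Rightarrow> ('a::complete_lattice \<Rightarrow> 'a) \<Rightarrow> 'o \<Rightarrow> 'a \<Rightarrow> 'a" where
  "iter r c = wfrec (r - Id) (\<lambda>C \<alpha>.
     if is_zero r \<alpha> then id
     else if \<exists>\<beta>. is_succ r \<beta> \<alpha> then c \<circ> C (THE \<beta>. is_succ r \<beta> \<alpha>)
     else (\<lambda>x. SUP \<beta>\<in>underS r \<alpha>. C \<beta> x))"

lemma is_succ_unique: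
  assumes "Well_order r" "is_succ r \<beta> \<alpha>" "is_succ r \<gamma> \<alpha>"
  shows "\<beta> = \<gamma>"
proof (rule antisymD)
  show "antisym r"
    using assms(1) by (simp add: order_on_defs)
  show "(\<beta>, \<gamma>) \<in> r" "(\<gamma>, \<beta>) \<in> r"
    using assms(2,3) by (auto simp: is_succ_def)
qed

lemma iter_unfold:
  assumes "Well_order r"
  shows "iter r c \<alpha> =
     (if is_zero r \<alpha> then id
      else if \<exists>\<beta>. is_succ r \<beta> \<alpha> then c \<circ> iter r c (THE \<beta>. is_succ r \<beta> \<alpha>)
      else (\<lambda>x. SUP \<beta>\<in>underS r \<alpha>. iter r c \<beta> x))"
proof -
  have wf: "wf (r - Id)"
    using assms by (simp add: well_order_on_def)
  have the: "(THE \<beta>. is_succ r \<beta> \<alpha>) = \<beta>" if "is_succ r \<beta> \<alpha>" for \<beta>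
    by (rule the_equality[where P = "\<lambda>\<beta>. is_succ r \<beta> \<alpha>", OF that is_succ_unique[OF assms _ that]])
  have cut_succ: "cut f (r - Id) \<alpha> (THE \<beta>. is_succ r \<beta> \<alpha>) = f (THE \<beta>. is_succ r \<beta> \<alpha>)"
    if "\<exists>\<beta>. is_succ r \<beta> \<alpha>" for f :: "_ \<Rightarrow> 'b \<Rightarrow> 'b"
  proof -
    from that obtain \<beta> where \<beta>: "is_succ r \<beta> \<alpha>" ..
    then have "(\<beta>, \<alpha>) \<in> r - Id"
      by (simp add: is_succ_def underS_def)
    then show ?thesis
      by (simp add: the[OF \<beta>] cut_def)
  qed
  have cut_lim: "(\<lambda>x. SUP \<beta>\<in>underS r \<alpha>. cut f (r - Id) \<alpha> \<beta> x) = (\<lambda>x. SUP \<beta>\<in>underS r \<alpha>. f \<beta> x)"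
    for f :: "_ \<Rightarrow> 'b \<Rightarrow> 'b"
    by (intro ext SUP_cong refl) (auto simp: cut_def underS_def)
  show ?thesis
    unfolding iter_def
    by (rule trans[OF wfrec[OF wf]]) (simp only: cut_succ cut_lim cong: if_cong)
qed

lemma iter_zero:
  assumes "Well_order r" "is_zero r \<alpha>"
  shows "iter r c \<alpha> = id"
  by (rule trans[OF iter_unfold[OF assms(1)]]) (simp add: assms(2))

lemma iter_succ:
  assumes "Well_order r" "is_succ r \<beta> \<alpha>"
  shows "iter r c \<alpha> = c \<circ> iter r c \<beta>"
proof -
  have "(THE \<beta>. is_succ r \<beta> \<alpha>) = \<beta>"
    by (rule the_equality[where P = "\<lambda>\<beta>. is_succ r \<beta> \<alpha>",
          OF assms(2) is_succ_unique[OF assms(1) _ assms(2)]])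
  moreover have "\<not> is_zero r \<alpha>"
    using assms(2) by (auto simp: is_zero_def is_succ_def)
  ultimately show ?thesis
    using assms(2) by (intro trans[OF iter_unfold[OF assms(1)]]) auto
qed

lemma iter_limit:
  assumes "Well_order r" "\<not> is_zero r \<alpha>" "\<nexists>\<beta>. is_succ r \<beta> \<alpha>"
  shows "iter r c \<alpha> = (\<lambda>x. SUP \<beta>\<in>underS r \<alpha>. iter r c \<beta> x)"
  by (rule trans[OF iter_unfold[OF assms(1)]]) (simp add: assms(2,3))

end

theory Submission
  imports Defs
begin

text \<open>
  Everything rests on one observation: for \<open>c \<in> EGM\<close> and \<open>P \<in> CBSMSL\<close> the conditions
  \<open>P \<subseteq> Fix c\<close> and \<open>c \<le> nu P\<close> are equivalent (\<open>subset_Fix_iff_le_nu\<close>). If \<open>c\<close> fixes \<open>P\<close> pointwise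
  and \<open>x \<in> P\<close> lies above \<open>y\<close>, then \<open>c y \<le> c x = x\<close>, so \<open>c y\<close> is a lower bound of the set whose
  meet is \<open>nu P y\<close>; conversely \<open>nu P\<close> fixes every \<open>x \<in> P\<close>, which forces \<open>c x \<le> x\<close>. This is the
  adjunction, and isotonicity of both maps follows from it. The identity \<open>Fix (nu P) = P\<close> holds
  because every value \<open>nu P y\<close> is a meet of elements of \<open>P\<close> and hence lies in \<open>P\<close>.

  As for the iterates, only \<open>iter r c \<alpha> \<in> EGM\<close> and \<open>c \<le> iter r c \<alpha> \<le> hat c\<close> need a transfinite induction
  (\<open>iter_EGM_le_hat\<close>, \<open>le_iter\<close>); the upper bound passes through successors because \<open>c\<close>
  fixes every value of \<open>hat c\<close>. The remaining identities hold for every \<open>d \<in> EGM\<close> with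
  \<open>c \<le> d \<le> hat c\<close> whatsoever (\<open>between_hat\<close>): composing \<open>hat c\<close> with such a \<open>d\<close> is squeezed between
  \<open>hat c\<close> and \<open>hat c \<circ> hat c = hat c\<close>, and \<open>Fix\<close>, being antitone, squeezes \<open>Fix d\<close> between
  \<open>Fix (hat c)\<close> and \<open>Fix c\<close>, which coincide.
\<close>

section \<open>Closure operations and their fixed points\<close>

lemma EGM_iff: "c \<in> EGM \<longleftrightarrow> mono c \<and> (\<forall>x. x \<le> c x) \<and> c bot = bot"
  by (simp add: EGM_def)

lemma EGM_mono: "c \<in> EGM \<Longrightarrow> x \<le> y \<Longrightarrow> c x \<le> c y"
  by (simp add: EGM_iff monoD)

lemma EGM_extensive: "c \<in> EGM \<Longrightarrow> x \<le> c x"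
  by (simp add: EGM_iff)

lemma EGM_bot: "c \<in> EGM \<Longrightarrow> c bot = bot"
  by (simp add: EGM_iff)

lemma id_in_EGM: "id \<in> EGM"
  by (simp add: EGM_iff mono_def)

lemma comp_in_EGM:
  assumes "c \<in> EGM" "d \<in> EGM"
  shows "c \<circ> d \<in> EGM"
proof -
  have "x \<le> c (d x)" for x
    using EGM_extensive[OF assms(2)] EGM_extensive[OF assms(1)] by (rule order_trans)
  then show ?thesis
    using assms by (simp add: EGM_iff mono_def)
qed

lemma SUP_in_EGM:
  fixes f :: "'i \<Rightarrow> 'a::complete_lattice \<Rightarrow> 'a"
  assumes "I \<noteq> {}" and "\<And>i. i \<in> I \<Longrightarrow> f i \<in> EGM"
  shows "(\<lambda>x. SUP i\<in>I. f i x) \<in> EGM"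
  unfolding EGM_iff
proof (intro conjI allI monoI)
  show "(SUP i\<in>I. f i x) \<le> (SUP i\<in>I. f i y)" if "x \<le> y" for x y
    by (rule SUP_subset_mono[OF order_refl]) (rule EGM_mono[OF assms(2) that])
  show "x \<le> (SUP i\<in>I. f i x)" for x
  proof -
    obtain i where i: "i \<in> I"
      using assms(1) by blast
    then show ?thesis
      using EGM_extensive[OF assms(2)[OF i]] by (rule SUP_upper2)
  qed
  have "(SUP i\<in>I. f i bot) = (SUP i\<in>I. bot)"
    using assms(2) by (intro SUP_cong) (auto simp: EGM_bot)
  then show "(SUP i\<in>I. f i bot) = bot"
    by simp
qed

text \<open>
  The arbitrary meet closure of the fixed points comes from \<open>c (Inf A) \<le> c a = a\<close> for each
  \<open>a \<in> A\<close>, which bounds \<open>c (Inf A)\<close> above by \<open>Inf A\<close>; extensivity gives the reverse inequality.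
\<close>

lemma Fix_in_CBSMSL:
  assumes "c \<in> EGM"
  shows "Fix c \<in> CBSMSL"
proof -
  have "Inf A \<in> Fix c" if "A \<subseteq> Fix c" for A
  proof -
    have "c (Inf A) \<le> a" if "a \<in> A" for a
      using EGM_mono[OF assms Inf_lower[OF that]] \<open>A \<subseteq> Fix c\<close> that by (auto simp: Fix_def)
    then have "c (Inf A) \<le> Inf A"
      by (rule Inf_greatest)
    then show ?thesis
      by (simp add: Fix_def antisym EGM_extensive[OF assms])
  qed
  moreover have "bot \<in> Fix c"
    by (simp add: Fix_def EGM_bot[OF assms])
  moreover have "Orderings.top \<in> Fix c"
    using EGM_extensive[OF assms, of Orderings.top] by (simp add: Fix_def top_unique)
  ultimately show ?thesis
    by (simp add: CBSMSL_def)
qed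

lemma nu_extensive: "y \<le> nu P y"
  unfolding nu_def by (rule Inf_greatest) simp

lemma nu_least: "x \<in> P \<Longrightarrow> y \<le> x \<Longrightarrow> nu P y \<le> x"
  unfolding nu_def by (rule Inf_lower) simp

lemma nu_fixes: "x \<in> P \<Longrightarrow> nu P x = x"
  using nu_least[OF _ order_refl] nu_extensive by (rule order_antisym)

lemma nu_in: "P \<in> CBSMSL \<Longrightarrow> nu P y \<in> P"
  by (simp add: nu_def CBSMSL_def)

lemma nu_in_EGM:
  assumes "P \<in> CBSMSL"
  shows "nu P \<in> EGM"
proof -
  have "nu P x \<le> nu P y" if "x \<le> y" for x y
    using nu_in[OF assms] order_trans[OF that nu_extensive] by (rule nu_least)
  moreover have "nu P bot = bot"
    using assms by (simp add: nu_fixes CBSMSL_def)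
  ultimately show ?thesis
    by (simp add: EGM_iff mono_def nu_extensive)
qed

lemma Fix_nu:
  assumes "P \<in> CBSMSL"
  shows "Fix (nu P) = P"
proof
  show "Fix (nu P) \<subseteq> P"
  proof
    fix x assume "x \<in> Fix (nu P)"
    then show "x \<in> P"
      using nu_in[OF assms, of x] by (simp add: Fix_def)
  qed
  show "P \<subseteq> Fix (nu P)"
    by (auto simp: Fix_def nu_fixes)
qed

section \<open>The adjunction\<close>

lemma subset_Fix_iff_le_nu:
  assumes "c \<in> EGM"
  shows "P \<subseteq> Fix c \<longleftrightarrow> c \<le> nu P"
proof
  assume P: "P \<subseteq> Fix c"
  have "c y \<le> x" if "x \<in> P" "y \<le> x" for x y
    using EGM_mono[OF assms \<open>y \<le> x\<close>] P \<open>x \<in> P\<close> by (auto simp: Fix_def)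
  then have "c y \<le> nu P y" for y
    unfolding nu_def by (intro Inf_greatest) auto
  then show "c \<le> nu P"
    by (simp add: le_fun_def)
next
  assume le: "c \<le> nu P"
  have "c x = x" if "x \<in> P" for x
    using le_funD[OF le, of x] EGM_extensive[OF assms, of x]
    by (intro order_antisym) (simp_all add: nu_fixes[OF that])
  then show "P \<subseteq> Fix c"
    by (auto simp: Fix_def)
qed

lemma partial_order_EGM_poset: "partial_order EGM_poset"
  by unfold_locales (auto simp: EGM_poset_def)

lemma partial_order_CBSMSL_dual: "partial_order (inv_gorder CBSMSL_poset)"
  by unfold_locales (auto simp: CBSMSL_poset_def)

lemma galois_connection_Fix_nu:
  "galois_connection
     \<lparr>orderA = EGM_poset :: ('a::complete_lattice \<Rightarrow> 'a) gorder, orderB = inv_gorder CBSMSL_poset,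
      lower = Fix, upper = nu\<rparr>"
proof (intro galois_connection.intro connection.intro galois_connection_axioms.intro;
    simp only: galcon.simps)
  show "partial_order (EGM_poset :: ('a \<Rightarrow> 'a) gorder)"
    by (rule partial_order_EGM_poset)
  show "partial_order (inv_gorder CBSMSL_poset)"
    by (rule partial_order_CBSMSL_dual)
qed (simp_all add: EGM_poset_def CBSMSL_poset_def Fix_in_CBSMSL nu_in_EGM subset_Fix_iff_le_nu)

section \<open>The idempotent hull\<close>

lemma hat_eq_nu_Fix: "hat c = nu (Fix c)"
  by (simp add: fun_eq_iff hat_def nu_def)

lemma hat_in_EGM: "c \<in> EGM \<Longrightarrow> hat c \<in> EGM"
  by (simp add: hat_eq_nu_Fix Fix_in_CBSMSL nu_in_EGM)

lemma Fix_hat: "c \<in> EGM \<Longrightarrow> Fix (hat c) = Fix c"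
  by (simp add: hat_eq_nu_Fix Fix_in_CBSMSL Fix_nu)

lemma hat_in_Fix: "c \<in> EGM \<Longrightarrow> hat c x \<in> Fix c"
  by (simp add: hat_eq_nu_Fix Fix_in_CBSMSL nu_in)

lemma hat_idem: "c \<in> EGM \<Longrightarrow> hat c (hat c x) = hat c x"
  using hat_in_Fix[of c x] Fix_hat[of c] by (auto simp: Fix_def)

lemma Fix_antimono:
  assumes "c \<in> EGM" "c \<le> d"
  shows "Fix d \<subseteq> Fix c"
proof
  fix x assume "x \<in> Fix d"
  then have "c x \<le> x"
    using le_funD[OF assms(2), of x] by (simp add: Fix_def)
  then show "x \<in> Fix c"
    by (simp add: Fix_def antisym EGM_extensive[OF assms(1)])
qed

text \<open>
  These identities are stated for an arbitrary \<open>d\<close> in the interval between \<open>c\<close> and its hull, so that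
  the transfinite induction only has to locate the iterates in that interval.
\<close>

lemma between_hat:
  assumes c: "c \<in> EGM" and d: "d \<in> EGM" and cd: "c \<le> d" and dh: "d \<le> hat c"
  shows "hat c \<circ> d = hat c" and "d \<circ> hat c = hat c" and "hat d = hat c"
proof -
  note h = hat_in_EGM[OF c]
  show "hat c \<circ> d = hat c"
  proof (intro ext antisym)
    fix x
    have "hat c (d x) \<le> hat c (hat c x)"
      by (rule EGM_mono[OF h le_funD[OF dh]])
    then show "(hat c \<circ> d) x \<le> hat c x"
      by (simp add: hat_idem[OF c])
    show "hat c x \<le> (hat c \<circ> d) x"
      by (simp add: EGM_mono[OF h EGM_extensive[OF d]])
  qed
  show "d \<circ> hat c = hat c"
  proof (intro ext antisym)
    fix x
    show "(d \<circ> hat c) x \<le> hat c x"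
      using le_funD[OF dh, of "hat c x"] by (simp add: hat_idem[OF c])
    show "hat c x \<le> (d \<circ> hat c) x"
      by (simp add: EGM_extensive[OF d])
  qed
  have "Fix d = Fix c"
    using Fix_antimono[OF c cd] Fix_antimono[OF d dh] Fix_hat[OF c] by auto
  then show "hat d = hat c"
    by (simp add: hat_eq_nu_Fix)
qed

section \<open>Transfinite iterates\<close>

lemma iter_EGM_le_hat:
  assumes r: "Well_order r" and c: "c \<in> EGM"
  shows "iter r c \<alpha> \<in> EGM \<and> iter r c \<alpha> \<le> hat c"
proof (induction \<alpha> rule: wo_rel.well_order_induct[OF wo_rel.intro[OF r]])
  case (1 \<alpha>)
  then have IH: "iter r c \<beta> \<in> EGM" "iter r c \<beta> \<le> hat c" if "\<beta> \<in> underS r \<alpha>" for \<beta>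
    using that by (auto simp: underS_def)
  consider "is_zero r \<alpha>" | \<beta> where "is_succ r \<beta> \<alpha>"
    | "\<not> is_zero r \<alpha>" "\<nexists>\<beta>. is_succ r \<beta> \<alpha>"
    by blast
  then show ?case
  proof cases
    case 1
    then show ?thesis
      unfolding iter_zero[OF r 1]
      by (intro conjI id_in_EGM le_funI) (simp add: EGM_extensive[OF hat_in_EGM[OF c]])
  next
    case 2
    then have \<beta>: "\<beta> \<in> underS r \<alpha>"
      by (simp add: is_succ_def)
    have "c (iter r c \<beta> x) \<le> hat c x" for x
    proof -
      have "c (iter r c \<beta> x) \<le> c (hat c x)"
        by (rule EGM_mono[OF c le_funD[OF IH(2)[OF \<beta>]]])
      also have "\<dots> = hat c x"
        using hat_in_Fix[OF c] by (simp add: Fix_def)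
      finally show ?thesis .
    qed
    then show ?thesis
      unfolding iter_succ[OF r 2]
      by (intro conjI comp_in_EGM[OF c IH(1)[OF \<beta>]] le_funI) simp
  next
    case 3
    then have "underS r \<alpha> \<noteq> {}"
      by (simp add: is_zero_def)
    then have "iter r c \<alpha> \<in> EGM"
      unfolding iter_limit[OF r 3] using IH(1) by (rule SUP_in_EGM)
    moreover have "iter r c \<alpha> \<le> hat c"
      unfolding iter_limit[OF r 3] using IH(2) by (auto simp: le_fun_def intro!: SUP_least)
    ultimately show ?thesis ..
  qed
qed

text \<open>
  Stage \<open>0\<close> is the identity, which need not lie above \<open>c\<close>, so at a limit \<open>\<alpha>\<close> the argument has to
  exhibit a nonzero earlier stage: since \<open>\<alpha>\<close> is no successor, every stage below \<open>\<alpha>\<close> has a later one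
  below \<open>\<alpha>\<close>, and being later than some stage makes it nonzero.
\<close>

lemma le_iter:
  assumes r: "Well_order r" and c: "c \<in> EGM"
  shows "\<not> is_zero r \<alpha> \<longrightarrow> c \<le> iter r c \<alpha>"
proof (induction \<alpha> rule: wo_rel.well_order_induct[OF wo_rel.intro[OF r]])
  case (1 \<alpha>)
  show ?case
  proof
    assume nz: "\<not> is_zero r \<alpha>"
    show "c \<le> iter r c \<alpha>"
    proof (cases "\<exists>\<beta>. is_succ r \<beta> \<alpha>")
      case True
      then obtain \<beta> where \<beta>: "is_succ r \<beta> \<alpha>" ..
      have "x \<le> iter r c \<beta> x" for x
        using iter_EGM_le_hat[OF r c] by (blast intro: EGM_extensive)
      then show ?thesis
        by (simp add: iter_succ[OF r \<beta>] le_fun_def EGM_mono[OF c])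
    next
      case False
      obtain \<beta> where \<beta>: "\<beta> \<in> underS r \<alpha>"
        using nz by (auto simp: is_zero_def)
      obtain \<gamma> where \<gamma>: "\<gamma> \<in> underS r \<alpha>" "(\<gamma>, \<beta>) \<notin> r"
        using False \<beta> by (auto simp: is_succ_def)
      have "\<beta> \<in> Field r" "\<gamma> \<in> Field r"
        using \<beta> \<gamma>(1) by (simp_all add: underS_Field)
      then have "(\<beta>, \<gamma>) \<in> r" "\<beta> \<noteq> \<gamma>"
        using wo_rel.TOTALS[OF wo_rel.intro[OF r]] \<gamma>(2) by blast+
      then have "\<not> is_zero r \<gamma>"
        by (auto simp: is_zero_def underS_def)
      then have "c \<le> iter r c \<gamma>"
        using 1 \<gamma>(1) by (simp add: underS_def)
      then show ?thesis
        unfolding iter_limit[OF r nz False] using \<gamma>(1)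
        by (auto simp: le_fun_def intro: SUP_upper2)
    qed
  qed
qed

theorem mainTheorem1:
  shows "isotone (EGM_poset :: ('a::complete_lattice \<Rightarrow> 'a) gorder) (inv_gorder CBSMSL_poset) Fix
    \<and> isotone (inv_gorder CBSMSL_poset) (EGM_poset :: ('a \<Rightarrow> 'a) gorder) nu
    \<and> galois_connection
        \<lparr>orderA = EGM_poset :: ('a \<Rightarrow> 'a) gorder, orderB = inv_gorder CBSMSL_poset,
         lower = Fix, upper = nu\<rparr>
    \<and> (\<forall>P \<in> (CBSMSL :: 'a set set). Fix (nu P) = P)
    \<and> (\<forall>c \<in> (EGM :: ('a \<Rightarrow> 'a) set).
         hat c = nu (Fix c)
         \<and> (\<forall>r :: 'o rel. Well_order r \<longrightarrow>
              (\<forall>\<alpha> \<in> Field r. \<not> is_zero r \<alpha> \<longrightarrow>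
                 iter r c \<alpha> \<in> EGM
                 \<and> c \<le> iter r c \<alpha> \<and> iter r c \<alpha> \<le> hat c
                 \<and> hat c \<circ> iter r c \<alpha> = hat c \<and> iter r c \<alpha> \<circ> hat c = hat c
                 \<and> hat (iter r c \<alpha>) = hat c)))"
proof (intro conjI ballI allI impI)
  let ?G = "\<lparr>orderA = EGM_poset :: ('a \<Rightarrow> 'a) gorder, orderB = inv_gorder CBSMSL_poset,
    lower = Fix, upper = nu\<rparr>"
  show gc: "galois_connection ?G"
    by (rule galois_connection_Fix_nu)
  show "isotone (EGM_poset :: ('a \<Rightarrow> 'a) gorder) (inv_gorder CBSMSL_poset) Fix"
    using galois_connection.lower_iso[OF gc] by simp
  show "isotone (inv_gorder CBSMSL_poset) (EGM_poset :: ('a \<Rightarrow> 'a) gorder) nu"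
    using galois_connection.upper_iso[OF gc] by simp
next
  fix P :: "'a set" assume "P \<in> CBSMSL"
  then show "Fix (nu P) = P"
    by (rule Fix_nu)
next
  fix c :: "'a \<Rightarrow> 'a"
  show "hat c = nu (Fix c)"
    by (rule hat_eq_nu_Fix)
next
  fix c :: "'a \<Rightarrow> 'a" and r :: "'o rel" and \<alpha>
  assume c: "c \<in> EGM" and r: "Well_order r" and nz: "\<not> is_zero r \<alpha>"
  show egm: "iter r c \<alpha> \<in> EGM" and upper: "iter r c \<alpha> \<le> hat c"
    using iter_EGM_le_hat[OF r c] by auto
  show lower: "c \<le> iter r c \<alpha>"
    using le_iter[OF r c] nz by blast
  show "hat c \<circ> iter r c \<alpha> = hat c" "iter r c \<alpha> \<circ> hat c = hat c" "hat (iter r c \<alpha>) = hat c"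
    by (rule between_hat[OF c egm lower upper])+
qed

end
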